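(* Let $\mathbb{K}=\mathbb{R}$ or $\mathbb{K}=\mathbb{C}$, let $f$ be a $\mathbb{K}$-valued function that is at least three times differentiable in a neighborhood in $\mathbb{K}$ of a simple zero $\alpha$ of $f$ (so $f(\alpha)=0$, $f'(\alpha)\neq 0$), and let $p\in\mathbb{K}$ be any fixed parameter (constant, hence bounded in magnitude). Put $$u(x)=\frac{f(x)}{f'(x)},\qquad A_{\lambda}(x)=\frac{f^{(\lambda)}(x)}{\lambda!\,f'(x)}\quad(\lambda=1,2,3).$$ Then, if the initial approximation $x_0$ is sufficiently close to $\alpha$, the iterative method $$x_{k+1}=x_k-\frac{u(x_k)\bigl(1+p\,u(x_k)\bigr)}{1+\bigl(p-A_2(x_k)\bigr)u(x_k)}\qquad (k=0,1,2,\ldots)$$ converges to $\alpha$ with order of convergence three, and its asymptotic error constant is $$\lim_{k\to\infty}\left|\frac{x_{k+1}-\alpha}{(x_k-\alpha)^3}\right|=\left|A_2(\alpha)^2-A_3(\alpha)+p\,A_2(\alpha)\right|.$$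
   Context: Order of convergence three (cubic convergence) is understood in the sense that $x_k\to\alpha$ and $|x_{k+1}-\alpha|=O(|x_k-\alpha|^3)$; the constant in the displayed limit may vanish for special values of $p$. The limit is understood for sequences with $x_k\neq\alpha$ for all $k$. *)

theory Defs
  imports "HOL-Analysis.Analysis" "HOL-Library.Landau_Symbols"
begin

text \<open>
  All notions are polymorphic over normed fields, so that they can be used at both \<^typ>\<open>real\<close>
  (real differentiability) and \<^typ>\<open>complex\<close> (complex differentiability).
\<close>

text \<open>
  \<open>f, f', \<dots>, f\<^sup>(\<^sup>n\<^sup>-\<^sup>1\<^sup>)\<close> are differentiable at every point of some neighbourhood of \<open>a\<close>, i.e. the first
  \<open>n\<close> derivatives exist there. Continuity of the last one is not required.
\<close>
definition times_differentiable_near ::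
    "nat \<Rightarrow> ('a::real_normed_field \<Rightarrow> 'a) \<Rightarrow> 'a \<Rightarrow> bool" where
  "times_differentiable_near n f a \<longleftrightarrow>
     (\<forall>\<^sub>F y in nhds a. \<forall>j<n. (deriv ^^ j) f field_differentiable (at y))"

definition newton_quot :: "('a::real_normed_field \<Rightarrow> 'a) \<Rightarrow> 'a \<Rightarrow> 'a" where
  "newton_quot f y = f y / deriv f y"

definition A_coeff :: "nat \<Rightarrow> ('a::real_normed_field \<Rightarrow> 'a) \<Rightarrow> 'a \<Rightarrow> 'a" where
  "A_coeff l f y = (deriv ^^ l) f y / (fact l * deriv f y)"

definition iter_step :: "('a::real_normed_field \<Rightarrow> 'a) \<Rightarrow> 'a \<Rightarrow> 'a \<Rightarrow> 'a" where
  "iter_step f p y =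
     y - newton_quot f y * (1 + p * newton_quot f y) /
         (1 + (p - A_coeff 2 f y) * newton_quot f y)"

text \<open>
  Since \<^const>\<open>deriv\<close> and division are total, we record separately that the step at \<open>y\<close> is
  meaningful: \<open>f'(y)\<close> and \<open>f''(y)\<close> exist and no division by zero takes place.
\<close>
definition iter_step_defined :: "('a::real_normed_field \<Rightarrow> 'a) \<Rightarrow> 'a \<Rightarrow> 'a \<Rightarrow> bool" where
  "iter_step_defined f p y \<longleftrightarrow>
     f field_differentiable (at y) \<and> deriv f field_differentiable (at y) \<and>
     deriv f y \<noteq> 0 \<and> 1 + (p - A_coeff 2 f y) * newton_quot f y \<noteq> 0"

definition converges_cubically :: "(nat \<Rightarrow> 'a::real_normed_field) \<Rightarrow> 'a \<Rightarrow> bool" where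
  "converges_cubically x a \<longleftrightarrow>
     x \<longlonglongrightarrow> a \<and> (\<lambda>k. norm (x (Suc k) - a)) \<in> O(\<lambda>k. norm (x k - a) ^ 3)"

end

theory Submission
  imports Defs
begin

text \<open>
  Write \<open>f(y) = c\<^sub>1e + c\<^sub>2e\<^sup>2 + c\<^sub>3e\<^sup>3 + o(e\<^sup>3)\<close> with \<open>e = y - \<alpha>\<close>. Clearing the denominators \<open>f'(y)\<close> turns
  the error after one step into \<open>N / Q\<close> with
  \<open>Q = D\<^sup>2 + (p D - S) F\<close> and \<open>N = e Q - F (D + p F)\<close>, where \<open>F = f(y)\<close>, \<open>D = f'(y)\<close>,
  \<open>S = f''(y)/2\<close>. Here \<open>Q\<close> tends to \<open>c\<^sub>1\<^sup>2 \<noteq> 0\<close>, while in \<open>N\<close> the terms of orders one and two in \<open>e\<close>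
  cancel and leave \<open>(c\<^sub>2\<^sup>2 - c\<^sub>1c\<^sub>3 + p c\<^sub>1c\<^sub>2) e\<^sup>3 + o(e\<^sup>3)\<close>. Dividing by \<open>c\<^sub>1\<^sup>2\<close> gives the asymptotic
  constant \<open>A\<^sub>2\<^sup>2 - A\<^sub>3 + p A\<^sub>2\<close> (lemma \<open>iter_step_error_tendsto\<close>). Everything else is
  the general fact that a map whose error is asymptotically a multiple of the cube of the old
  error attracts a neighbourhood of its fixed point cubically (lemma \<open>cubic_attraction\<close>).

  As the third derivative may be discontinuous, the expansions of \<open>f\<close> and \<open>f'\<close> are obtained
  in Peano form: differentiability of \<open>f''\<close> at \<open>\<alpha>\<close> gives its first-order expansion, which
  is integrated twice with the mean value inequality
  (lemma \<open>antiderivative_expansion\<close>). That inequality holds over any real normed field,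
  so the real and the complex case have one proof.
\<close>

section \<open>Peano expansions\<close>

text \<open>
  A form of l'Hopital's rule that survives in the complex plane: after subtracting the main
  term, \<open>g\<close> has a derivative that is at most \<open>\<epsilon> r\<^sup>n\<close> on a small ball of radius \<open>r\<close>, and the ball is
  convex, so the mean value inequality applies.
\<close>
lemma antiderivative_expansion:
  fixes g g' :: "'a::real_normed_field \<Rightarrow> 'a"
  assumes der: "\<forall>\<^sub>F y in nhds a. (g has_field_derivative g' y) (at y)"
    and zero: "g a = 0" "g' a = 0" and n: "n > 0"
    and lim: "((\<lambda>y. g' y / (y - a) ^ n) \<longlongrightarrow> L) (at a)"
  shows "((\<lambda>y. g y / (y - a) ^ Suc n) \<longlongrightarrow> L / of_nat (Suc n)) (at a)"
proof -
  define M where "M = L / of_nat (Suc n)"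
  have M: "of_nat (Suc n) * M = L"
    by (simp add: M_def del: of_nat_Suc)
  define h where "h = (\<lambda>y. g y - M * (y - a) ^ Suc n)"
  define h' where "h' = (\<lambda>y. g' y - L * (y - a) ^ n)"
  have "((\<lambda>y. g y / (y - a) ^ Suc n) \<longlongrightarrow> M) (at a)"
  proof (rule tendstoI)
    fix \<epsilon> :: real assume \<epsilon>: "\<epsilon> > 0"
    have "\<forall>\<^sub>F y in nhds a. y \<noteq> a \<longrightarrow> dist (g' y / (y - a) ^ n) L < \<epsilon> / 2"
      using tendstoD[OF lim, of "\<epsilon> / 2"] \<epsilon> by (simp add: eventually_at_filter)
    with der have "\<forall>\<^sub>F y in nhds a. (g has_field_derivative g' y) (at y) \<and>
        (y \<noteq> a \<longrightarrow> dist (g' y / (y - a) ^ n) L < \<epsilon> / 2)"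
      by (rule eventually_conj)
    then obtain d where d: "d > 0"
      and dd: "\<And>y. dist y a < d \<Longrightarrow> (g has_field_derivative g' y) (at y)"
      and dl: "\<And>y. dist y a < d \<Longrightarrow> y \<noteq> a \<Longrightarrow> dist (g' y / (y - a) ^ n) L < \<epsilon> / 2"
      unfolding eventually_nhds_metric by blast
    have h'_bound: "norm (h' y) \<le> \<epsilon> / 2 * norm (y - a) ^ n" if "dist y a < d" for y
    proof (cases "y = a")
      case True
      then show ?thesis using zero n by (simp add: h'_def zero_power)
    next
      case False
      have "h' y = (g' y / (y - a) ^ n - L) * (y - a) ^ n"
        using False by (simp add: h'_def algebra_simps)
      then have "norm (h' y) = dist (g' y / (y - a) ^ n) L * norm (y - a) ^ n"
        by (simp add: norm_mult norm_power dist_norm)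
      also have "\<dots> \<le> \<epsilon> / 2 * norm (y - a) ^ n"
        using dl[OF that False] by (intro mult_right_mono) auto
      finally show ?thesis .
    qed
    have "dist (g y / (y - a) ^ Suc n) M < \<epsilon>" if y: "dist y a < d" "y \<noteq> a" for y
    proof -
      have in_ball: "dist z a < d" if "z \<in> cball a (dist y a)" for z
        using that y(1) by (simp add: dist_commute)
      have "norm (h y - h a) \<le> (\<epsilon> / 2 * norm (y - a) ^ n) * norm (y - a)"
      proof (rule field_differentiable_bound[where S = "cball a (dist y a)" and f' = h'])
        fix z assume z: "z \<in> cball a (dist y a)"
        have "(h has_field_derivative (g' z - M * (of_nat (Suc n) * (z - a) ^ n))) (at z)"
          unfolding h_def
          by (rule derivative_eq_intros dd in_ball z refl)+ (simp add: algebra_simps)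
        also have "g' z - M * (of_nat (Suc n) * (z - a) ^ n) = h' z"
          by (simp only: h'_def M[symmetric]) (simp only: mult_ac)
        finally show "(h has_field_derivative h' z) (at z within cball a (dist y a))"
          by (rule has_field_derivative_at_within)
        have "norm (h' z) \<le> \<epsilon> / 2 * norm (z - a) ^ n"
          by (rule h'_bound[OF in_ball[OF z]])
        also have "\<dots> \<le> \<epsilon> / 2 * norm (y - a) ^ n"
          using z \<epsilon> by (intro mult_left_mono power_mono) (auto simp: dist_norm norm_minus_commute)
        finally show "norm (h' z) \<le> \<epsilon> / 2 * norm (y - a) ^ n" .
      qed (auto simp: dist_commute)
      then have hb: "norm (h y) \<le> \<epsilon> / 2 * norm (y - a) ^ Suc n"
        using zero by (simp add: h_def mult_ac)
      have "g y / (y - a) ^ Suc n - M = h y / (y - a) ^ Suc n"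
        using y(2) by (simp add: h_def diff_divide_distrib del: power_Suc)
      then have "dist (g y / (y - a) ^ Suc n) M = norm (h y) / norm (y - a) ^ Suc n"
        by (simp add: dist_norm norm_divide norm_power del: power_Suc)
      also have "\<dots> \<le> \<epsilon> / 2"
        using hb y(2) by (simp add: divide_le_eq del: power_Suc)
      finally show ?thesis using \<epsilon> by simp
    qed
    with d show "\<forall>\<^sub>F y in at a. dist (g y / (y - a) ^ Suc n) M < \<epsilon>"
      unfolding eventually_at by blast
  qed
  then show ?thesis by (simp only: M_def)
qed

lemma times_differentiable_near_3D:
  assumes "times_differentiable_near 3 f a"
  shows "\<forall>\<^sub>F y in nhds a. (f has_field_derivative deriv f y) (at y)"
    and "\<forall>\<^sub>F y in nhds a. (deriv f has_field_derivative (deriv ^^ 2) f y) (at y)"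
    and "((deriv ^^ 2) f has_field_derivative (deriv ^^ 3) f a) (at a)"
proof -
  have ev: "\<forall>\<^sub>F y in nhds a. \<forall>j<3. (deriv ^^ j) f field_differentiable (at y)"
    using assms by (simp add: times_differentiable_near_def)
  have step: "((deriv ^^ j) f has_field_derivative (deriv ^^ Suc j) f y) (at y)"
    if "\<forall>j<3. (deriv ^^ j) f field_differentiable (at y)" "j < 3" for j y
    using that by (simp add: DERIV_deriv_iff_field_differentiable)
  show "\<forall>\<^sub>F y in nhds a. (f has_field_derivative deriv f y) (at y)"
    using ev by eventually_elim (use step[of _ 0] in simp)
  show "\<forall>\<^sub>F y in nhds a. (deriv f has_field_derivative (deriv ^^ 2) f y) (at y)"
    using ev by eventually_elim (use step[of _ 1] in \<open>simp add: numeral_2_eq_2\<close>)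
  show "((deriv ^^ 2) f has_field_derivative (deriv ^^ 3) f a) (at a)"
    using step[OF eventually_nhds_x_imp_x[OF ev], of 2]
    by (simp add: numeral_3_eq_3 numeral_2_eq_2)
qed

text \<open>
  The remainders are stated as quotients with a limit, so that they can be substituted into exact
  polynomial identities. With \<open>c\<^sub>j\<close> the \<open>j\<close>-th derivative at \<open>a\<close> over \<open>j!\<close>, the limits are those
  obtained by differentiating the cubic Taylor polynomial term by term.
\<close>
lemma peano_expansions:
  fixes f :: "'a::real_normed_field \<Rightarrow> 'a"
  assumes "times_differentiable_near 3 f a" and f0: "f a = 0"
    and c1: "deriv f a = c1" and c2: "(deriv ^^ 2) f a = 2 * c2" and c3: "(deriv ^^ 3) f a = 6 * c3"
  shows "((\<lambda>y. ((deriv ^^ 2) f y / 2 - c2) / (y - a)) \<longlongrightarrow> 3 * c3) (at a)"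
    and "((\<lambda>y. (deriv f y - c1 - 2 * c2 * (y - a)) / (y - a) ^ 2) \<longlongrightarrow> 3 * c3) (at a)"
    and "((\<lambda>y. (f y - c1 * (y - a) - c2 * (y - a) ^ 2) / (y - a) ^ 3) \<longlongrightarrow> c3) (at a)"
proof -
  note D = times_differentiable_near_3D[OF assms(1)]
  have l2: "((\<lambda>y. ((deriv ^^ 2) f y - 2 * c2) / (y - a)) \<longlongrightarrow> 6 * c3) (at a)"
    using D(3) by (simp only: has_field_derivative_iff c2 c3)
  have "((deriv ^^ 2) f y - 2 * c2) / (y - a) / 2 = ((deriv ^^ 2) f y / 2 - c2) / (y - a)" for y
    by (cases "y = a") (simp_all add: field_simps)
  moreover have "((\<lambda>y. ((deriv ^^ 2) f y - 2 * c2) / (y - a) / 2) \<longlongrightarrow> 6 * c3 / 2) (at a)"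
    by (intro tendsto_divide l2 tendsto_const) simp
  ultimately show "((\<lambda>y. ((deriv ^^ 2) f y / 2 - c2) / (y - a)) \<longlongrightarrow> 3 * c3) (at a)"
    by simp
  have "((\<lambda>y. (deriv f y - c1 - 2 * c2 * (y - a)) / (y - a) ^ Suc 1)
          \<longlongrightarrow> 6 * c3 / of_nat (Suc 1)) (at a)"
  proof (rule antiderivative_expansion[where g' = "\<lambda>y. (deriv ^^ 2) f y - 2 * c2"])
    show "\<forall>\<^sub>F y in nhds a. ((\<lambda>y. deriv f y - c1 - 2 * c2 * (y - a)) has_field_derivative
            (deriv ^^ 2) f y - 2 * c2) (at y)"
      using D(2) by eventually_elim (auto intro!: derivative_eq_intros)
  qed (use l2 c1 c2 in simp_all)
  then show l1: "((\<lambda>y. (deriv f y - c1 - 2 * c2 * (y - a)) / (y - a) ^ 2) \<longlongrightarrow> 3 * c3) (at a)"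
    by (simp add: numeral_2_eq_2[symmetric])
  have "((\<lambda>y. (f y - c1 * (y - a) - c2 * (y - a) ^ 2) / (y - a) ^ Suc 2)
          \<longlongrightarrow> 3 * c3 / of_nat (Suc 2)) (at a)"
  proof (rule antiderivative_expansion[where g' = "\<lambda>y. deriv f y - c1 - 2 * c2 * (y - a)"])
    show "\<forall>\<^sub>F y in nhds a. ((\<lambda>y. f y - c1 * (y - a) - c2 * (y - a) ^ 2) has_field_derivative
            deriv f y - c1 - 2 * c2 * (y - a)) (at y)"
      using D(1) by eventually_elim (auto intro!: derivative_eq_intros)
  qed (use l1 c1 f0 in simp_all)
  then show "((\<lambda>y. (f y - c1 * (y - a) - c2 * (y - a) ^ 2) / (y - a) ^ 3) \<longlongrightarrow> c3) (at a)"
    by (simp add: numeral_3_eq_3[symmetric])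
qed

section \<open>The error after one step\<close>

text \<open>
  By continuity of \<open>f\<close>, \<open>f'\<close> and \<open>f''\<close> at \<open>a\<close>, both \<open>f'(y)\<close> and the denominator
  are close to their values \<open>f'(a)\<close> and \<open>1\<close> at the zero.
\<close>
lemma iter_step_defined_near:
  fixes f :: "'a::real_normed_field \<Rightarrow> 'a"
  assumes td: "times_differentiable_near 3 f a" and f0: "f a = 0" and f1: "deriv f a \<noteq> 0"
  shows "\<forall>\<^sub>F y in nhds a. iter_step_defined f p y"
proof -
  note D = times_differentiable_near_3D[OF td]
  have c0: "isCont f a" and c1: "isCont (deriv f) a" and c2: "isCont ((deriv ^^ 2) f) a"
    using eventually_nhds_x_imp_x[OF D(1)] eventually_nhds_x_imp_x[OF D(2)] D(3)
    by (auto intro: DERIV_isCont)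
  have nonzero_near: "\<forall>\<^sub>F y in nhds a. h y \<noteq> 0" if "isCont h a" "h a \<noteq> 0" for h :: "'a \<Rightarrow> 'a"
    using that by (intro tendsto_imp_eventually_ne)
      (simp_all only: isCont_def tendsto_at_iff_tendsto_nhds)
  have "isCont (\<lambda>y. 1 + (p - A_coeff 2 f y) * newton_quot f y) a"
    unfolding A_coeff_def newton_quot_def
    using c0 c1 c2 f1 by (intro continuous_intros) auto
  then have "\<forall>\<^sub>F y in nhds a. 1 + (p - A_coeff 2 f y) * newton_quot f y \<noteq> 0"
    by (rule nonzero_near) (simp add: newton_quot_def f0)
  with D(1,2) nonzero_near[OF c1 f1] show ?thesis
    by eventually_elim (auto simp: iter_step_defined_def field_differentiable_def)
qed

lemma iter_step_error_eq:
  fixes f :: "'a::real_normed_field \<Rightarrow> 'a"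
  assumes "iter_step_defined f p y"
  defines "F \<equiv> f y" and "D \<equiv> deriv f y" and "S \<equiv> (deriv ^^ 2) f y / 2"
  shows "iter_step f p y - a =
           ((y - a) * (D\<^sup>2 + (p * D - S) * F) - F * (D + p * F)) / (D\<^sup>2 + (p * D - S) * F)"
proof -
  have A: "A_coeff 2 f y = S / D" and u: "newton_quot f y = F / D"
    by (simp_all add: A_coeff_def newton_quot_def F_def D_def S_def)
  have D: "D \<noteq> 0" and q: "1 + (p - S / D) * (F / D) \<noteq> 0"
    using assms(1) unfolding iter_step_defined_def A u by (auto simp: D_def)
  have q': "D\<^sup>2 + (p * D - S) * F = D\<^sup>2 * (1 + (p - S / D) * (F / D))"
    using D by (simp add: field_simps power2_eq_square)
  have n': "F * (D + p * F) = D\<^sup>2 * (F / D * (1 + p * (F / D)))"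
    using D by (simp add: field_simps power2_eq_square)
  have "D\<^sup>2 + (p * D - S) * F \<noteq> 0"
    unfolding q' using D q by simp
  moreover have "iter_step f p y = y - F * (D + p * F) / (D\<^sup>2 + (p * D - S) * F)"
    unfolding q' n' iter_step_def A u using D by simp
  ultimately show ?thesis
    by (simp add: diff_divide_distrib)
qed

text \<open>
  The cancellation behind cubic convergence, with \<open>s\<close>, \<open>d\<close>, \<open>g\<close> in the role of the remainder
  quotients of \<open>f''/2\<close>, \<open>f'\<close> and \<open>f\<close>: the numerator of the error is divisible by \<open>e\<^sup>3\<close>.
\<close>
lemma numerator_cancellation:
  fixes e c1 c2 s d g p :: "'a::comm_ring_1"
  defines "G \<equiv> c1 + c2 * e + g * e\<^sup>2"
  defines "F \<equiv> e * G" and "D \<equiv> c1 + 2 * c2 * e + d * e\<^sup>2" and "S \<equiv> c2 + s * e"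
  shows "e * (D\<^sup>2 + (p * D - S) * F) - F * (D + p * F) =
           e ^ 3 * (c2 * (c2 + (d - g) * e + p * G) + (d - g) * (D + p * F) - s * G)"
  unfolding F_def D_def S_def G_def
  by (simp add: algebra_simps power2_eq_square power3_eq_cube)

lemma iter_step_error_tendsto:
  fixes f :: "'a::real_normed_field \<Rightarrow> 'a"
  assumes td: "times_differentiable_near 3 f a" and f0: "f a = 0" and f1: "deriv f a \<noteq> 0"
  shows "((\<lambda>y. (iter_step f p y - a) / (y - a) ^ 3)
            \<longlongrightarrow> (A_coeff 2 f a)\<^sup>2 - A_coeff 3 f a + p * A_coeff 2 f a) (at a)"
proof -
  define c1 c2 c3
    where c_defs: "c1 = deriv f a" "c2 = (deriv ^^ 2) f a / 2" "c3 = (deriv ^^ 3) f a / 6"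
  define s where "s = (\<lambda>y. ((deriv ^^ 2) f y / 2 - c2) / (y - a))"
  define d where "d = (\<lambda>y. (deriv f y - c1 - 2 * c2 * (y - a)) / (y - a) ^ 2)"
  define g where "g = (\<lambda>y. (f y - c1 * (y - a) - c2 * (y - a) ^ 2) / (y - a) ^ 3)"
  have c1: "c1 \<noteq> 0" using f1 by (simp add: c_defs)
  have lims: "(s \<longlongrightarrow> 3 * c3) (at a)" "(d \<longlongrightarrow> 3 * c3) (at a)" "(g \<longlongrightarrow> c3) (at a)"
    unfolding s_def d_def g_def
    by (rule peano_expansions[OF td f0]; simp add: c_defs)+
  define E where "E = (\<lambda>y. y - a)"
  define G where "G = (\<lambda>y. c1 + c2 * E y + g y * (E y)\<^sup>2)"
  define D where "D = (\<lambda>y. c1 + 2 * c2 * E y + d y * (E y)\<^sup>2)"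
  define S where "S = (\<lambda>y. c2 + s y * E y)"
  define N where "N = (\<lambda>y. c2 * (c2 + (d y - g y) * E y + p * G y)
                       + (d y - g y) * (D y + p * (E y * G y)) - s y * G y)"
  define Q where "Q = (\<lambda>y. (D y)\<^sup>2 + (p * D y - S y) * (E y * G y))"
  have E: "(E \<longlongrightarrow> 0) (at a)"
    unfolding E_def by (auto intro!: tendsto_eq_intros)
  have G: "(G \<longlongrightarrow> c1) (at a)" and D: "(D \<longlongrightarrow> c1) (at a)" and S: "(S \<longlongrightarrow> c2) (at a)"
    unfolding G_def D_def S_def using E lims by (auto intro!: tendsto_eq_intros)
  have N: "(N \<longlongrightarrow> c2 * (c2 + p * c1) + 2 * c3 * c1 - 3 * c3 * c1) (at a)"
    unfolding N_def by (rule tendsto_eq_intros E G D lims refl)+ (simp add: algebra_simps)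
  have Q: "(Q \<longlongrightarrow> c1\<^sup>2) (at a)"
    unfolding Q_def using E G D S by (auto intro!: tendsto_eq_intros)
  have "((\<lambda>y. N y / Q y) \<longlongrightarrow> (c2 * (c2 + p * c1) + 2 * c3 * c1 - 3 * c3 * c1) / c1\<^sup>2) (at a)"
    using N Q c1 by (intro tendsto_divide) auto
  also have "(c2 * (c2 + p * c1) + 2 * c3 * c1 - 3 * c3 * c1) / c1\<^sup>2 =
      (c2 / c1)\<^sup>2 - c3 / c1 + p * (c2 / c1)"
    using c1 by (simp add: field_simps power2_eq_square)
  also have "\<dots> = (A_coeff 2 f a)\<^sup>2 - A_coeff 3 f a + p * A_coeff 2 f a"
    by (simp add: A_coeff_def c_defs fact_numeral)
  finally have NQ: "((\<lambda>y. N y / Q y)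
      \<longlongrightarrow> (A_coeff 2 f a)\<^sup>2 - A_coeff 3 f a + p * A_coeff 2 f a) (at a)" .
  have "\<forall>\<^sub>F y in at a. y \<noteq> a \<and> iter_step_defined f p y"
    using iter_step_defined_near[OF td f0 f1, of p]
    by (auto simp: eventually_at_filter elim: eventually_mono)
  then have "\<forall>\<^sub>F y in at a. N y / Q y = (iter_step f p y - a) / (y - a) ^ 3"
  proof eventually_elim
    case (elim y)
    have e: "E y \<noteq> 0" using elim by (simp add: E_def)
    have "f y - c1 * E y - c2 * (E y)\<^sup>2 = g y * E y ^ 3"
      using e by (simp add: E_def g_def)
    then have fy: "f y = E y * G y"
      by (simp add: G_def algebra_simps power2_eq_square power3_eq_cube)
    have dy: "deriv f y = D y"
      using e by (simp add: E_def D_def d_def)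
    have sy: "(deriv ^^ 2) f y / 2 = S y"
      using e by (simp add: E_def S_def s_def)
    have "iter_step f p y - a = E y ^ 3 * N y / Q y"
      unfolding iter_step_error_eq[OF conjunct2[OF elim]] fy dy sy
      using numerator_cancellation[of "E y" c1 c2 "d y" p "s y" "g y"]
      by (simp add: N_def Q_def G_def D_def S_def E_def)
    then show ?case using e by (simp add: E_def)
  qed
  then show ?thesis
    by (rule Lim_transform_eventually[OF NQ])
qed

lemma iter_step_zero: "f a = 0 \<Longrightarrow> iter_step f p a = a"
  by (simp add: iter_step_def newton_quot_def)

section \<open>Cubic attraction\<close>

text \<open>
  Near \<open>a\<close> the error is at most \<open>K\<close> times the cube of the old error. In a ball of radius \<open>\<delta>\<close>
  with \<open>K \<delta>\<^sup>2 \<le> 1/2\<close> the error is therefore at least halved in each step, so orbits stay in the ball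
  and converge; the asymptotic statements follow by evaluating along the orbit.
\<close>
lemma cubic_attraction:
  fixes \<Phi> :: "'a::real_normed_field \<Rightarrow> 'a"
  assumes fix_a: "\<Phi> a = a" and P: "\<forall>\<^sub>F y in nhds a. P y"
    and lim: "((\<lambda>y. (\<Phi> y - a) / (y - a) ^ 3) \<longlongrightarrow> C) (at a)"
  shows "\<exists>\<delta>>0. \<forall>x :: nat \<Rightarrow> 'a. dist (x 0) a < \<delta> \<and> (\<forall>k. x (Suc k) = \<Phi> (x k)) \<longrightarrow>
           (\<forall>k. P (x k)) \<and> converges_cubically x a \<and>
           ((\<forall>k. x k \<noteq> a) \<longrightarrow>
              (\<lambda>k. norm ((x (Suc k) - a) / (x k - a) ^ 3)) \<longlonglongrightarrow> norm C)"
proof -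
  define K where "K = norm C + 1"
  have K: "K > 0" by (simp add: K_def add_nonneg_pos)
  have "\<forall>\<^sub>F y in at a. norm ((\<Phi> y - a) / (y - a) ^ 3) < K"
    using tendsto_norm[OF lim] by (rule order_tendstoD(2)) (simp add: K_def)
  then have "\<forall>\<^sub>F y in nhds a. y \<noteq> a \<longrightarrow> norm ((\<Phi> y - a) / (y - a) ^ 3) < K"
    by (simp add: eventually_at_filter)
  with P have "\<forall>\<^sub>F y in nhds a. P y \<and> (y \<noteq> a \<longrightarrow> norm ((\<Phi> y - a) / (y - a) ^ 3) < K)"
    by (rule eventually_conj)
  then obtain r where r: "r > 0" and rP: "\<And>y. dist y a < r \<Longrightarrow> P y"
    and rK: "\<And>y. dist y a < r \<Longrightarrow> y \<noteq> a \<Longrightarrow> norm ((\<Phi> y - a) / (y - a) ^ 3) < K"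
    unfolding eventually_nhds_metric by blast
  have cubic: "norm (\<Phi> y - a) \<le> K * norm (y - a) ^ 3" if "dist y a < r" for y
  proof (cases "y = a")
    case False
    then show ?thesis
      using rK[OF that] by (simp add: norm_divide norm_power divide_less_eq)
  qed (simp add: fix_a)
  define \<delta> where "\<delta> = min r (sqrt (1 / (2 * K)))"
  have \<delta>: "\<delta> > 0" "\<delta> \<le> r" using r K by (auto simp: \<delta>_def)
  have "\<delta>\<^sup>2 \<le> (sqrt (1 / (2 * K)))\<^sup>2"
    using \<delta> by (intro power_mono) (auto simp: \<delta>_def)
  then have K\<delta>: "K * \<delta>\<^sup>2 \<le> 1 / 2" using K by (simp add: field_simps)
  have half: "norm (\<Phi> y - a) \<le> norm (y - a) / 2" if y: "norm (y - a) < \<delta>" for y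
  proof -
    have "norm (\<Phi> y - a) \<le> K * norm (y - a) ^ 3"
      using y \<delta> by (intro cubic) (simp add: dist_norm)
    also have "\<dots> = (K * (norm (y - a))\<^sup>2) * norm (y - a)"
      by (simp add: power2_eq_square power3_eq_cube)
    also have "\<dots> \<le> (K * \<delta>\<^sup>2) * norm (y - a)"
      using y K by (intro mult_right_mono mult_left_mono power_mono) auto
    also have "\<dots> \<le> 1 / 2 * norm (y - a)"
      using K\<delta> by (intro mult_right_mono) auto
    finally show ?thesis by simp
  qed
  have "(\<forall>k. P (x k)) \<and> converges_cubically x a \<and>
           ((\<forall>k. x k \<noteq> a) \<longrightarrow>
              (\<lambda>k. norm ((x (Suc k) - a) / (x k - a) ^ 3)) \<longlonglongrightarrow> norm C)"
    if x0: "dist (x 0) a < \<delta>" and xS: "\<And>k. x (Suc k) = \<Phi> (x k)" for x :: "nat \<Rightarrow> 'a"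
  proof -
    have geom: "norm (x k - a) < \<delta> \<and> norm (x k - a) \<le> \<delta> * (1 / 2) ^ k" for k
    proof (induction k)
      case 0
      then show ?case using x0 by (simp add: dist_norm)
    next
      case (Suc k)
      have "norm (x (Suc k) - a) \<le> norm (x k - a) / 2"
        using half[of "x k"] Suc by (simp add: xS)
      moreover have "norm (x k - a) / 2 \<le> norm (x k - a)"
        by simp
      moreover have "\<delta> * (1 / 2) ^ Suc k = \<delta> * (1 / 2) ^ k / 2"
        by simp
      ultimately show ?case using Suc.IH by linarith
    qed
    have in_r: "dist (x k) a < r" for k
      using geom[of k] \<delta> by (simp add: dist_norm)
    have "(\<lambda>k. \<delta> * (1 / 2) ^ k) \<longlonglongrightarrow> 0"
      by (intro tendsto_mult_right_zero LIMSEQ_power_zero) simp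
    then have "(\<lambda>k. x k - a) \<longlonglongrightarrow> 0"
      by (rule Lim_null_comparison[rotated]) (simp add: geom)
    then have conv: "x \<longlonglongrightarrow> a" by (simp add: LIM_zero_iff)
    have "(\<lambda>k. norm (x (Suc k) - a)) \<in> O(\<lambda>k. norm (x k - a) ^ 3)"
      using cubic[OF in_r] by (intro bigoI[of _ K]) (simp add: xS norm_power)
    moreover have "(\<lambda>k. norm ((x (Suc k) - a) / (x k - a) ^ 3)) \<longlonglongrightarrow> norm C"
      if "\<forall>k. x k \<noteq> a"
    proof -
      have "filterlim x (at a) sequentially"
        using conv that by (simp add: filterlim_at)
      from tendsto_norm[OF filterlim_compose[OF lim this]] show ?thesis
        by (simp add: xS)
    qed
    ultimately show ?thesis using conv rP[OF in_r] by (simp add: converges_cubically_def)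
  qed
  with \<delta>(1) show ?thesis by blast
qed

theorem theorem3:
  shows "(\<forall>(f :: real \<Rightarrow> real) (\<alpha> :: real) (p :: real).
            times_differentiable_near 3 f \<alpha> \<and> f \<alpha> = 0 \<and> deriv f \<alpha> \<noteq> 0 \<longrightarrow>
            (\<exists>\<delta>>0. \<forall>x :: nat \<Rightarrow> real.
               dist (x 0) \<alpha> < \<delta> \<and> (\<forall>k. x (Suc k) = iter_step f p (x k)) \<longrightarrow>
                 (\<forall>k. iter_step_defined f p (x k)) \<and>
                 converges_cubically x \<alpha> \<and>
                 ((\<forall>k. x k \<noteq> \<alpha>) \<longrightarrow>
                    (\<lambda>k. norm ((x (Suc k) - \<alpha>) / (x k - \<alpha>) ^ 3))
                      \<longlonglongrightarrow> norm ((A_coeff 2 f \<alpha>)\<^sup>2 - A_coeff 3 f \<alpha> + p * A_coeff 2 f \<alpha>))))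
         \<and>
         (\<forall>(f :: complex \<Rightarrow> complex) (\<alpha> :: complex) (p :: complex).
            times_differentiable_near 3 f \<alpha> \<and> f \<alpha> = 0 \<and> deriv f \<alpha> \<noteq> 0 \<longrightarrow>
            (\<exists>\<delta>>0. \<forall>x :: nat \<Rightarrow> complex.
               dist (x 0) \<alpha> < \<delta> \<and> (\<forall>k. x (Suc k) = iter_step f p (x k)) \<longrightarrow>
                 (\<forall>k. iter_step_defined f p (x k)) \<and>
                 converges_cubically x \<alpha> \<and>
                 ((\<forall>k. x k \<noteq> \<alpha>) \<longrightarrow>
                    (\<lambda>k. norm ((x (Suc k) - \<alpha>) / (x k - \<alpha>) ^ 3))
                      \<longlonglongrightarrow> norm ((A_coeff 2 f \<alpha>)\<^sup>2 - A_coeff 3 f \<alpha> + p * A_coeff 2 f \<alpha>))))"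
  by (intro conjI allI impI cubic_attraction iter_step_zero iter_step_defined_near
        iter_step_error_tendsto) simp_all

end
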